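(* Let $G$ be a finite simple graph on $n$ vertices and let $t \ge 2$ be an integer. Then \[ N(G,K_t) \le n^{t-1}\sum_{v\in V(G)}\frac{1}{c(v)^t}\binom{c(v)}{t}. \] Moreover, equality holds if and only if $G$ is a regular complete multipartite graph.
   Context: $N(G,K_t)$ denotes the number of copies of the complete graph $K_t$ in $G$ (i.e. the number of $t$-vertex cliques). For each vertex $v \in V(G)$, $c(v)$ denotes the order (number of vertices) of the largest clique of $G$ containing $v$. The binomial coefficient $\binom{c}{t}$ is $0$ when $c<t$. A regular complete multipartite graph is a complete multipartite graph all of whose parts have the same size.
   Formalization: Equality is shown to hold iff G is regular complete multipartite or N(G,K_t)=0; the extra case is needed because for t≥3 any graph with no K_t (e.g. the path on 3 vertices, t=3) has both sides equal to 0. *)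

theory Defs
  imports Complex_Main "HOL-Library.Disjoint_Sets"
begin

(* A graph is given by its vertex set V and its set E of two-element edges {u, v}. *)

definition finite_simple_graph :: "'a set \<Rightarrow> 'a set set \<Rightarrow> bool" where
  "finite_simple_graph V E \<longleftrightarrow> finite V \<and> (\<forall>e\<in>E. e \<subseteq> V \<and> card e = 2)"

definition is_clique :: "'a set \<Rightarrow> 'a set set \<Rightarrow> 'a set \<Rightarrow> bool" where
  "is_clique V E K \<longleftrightarrow> K \<subseteq> V \<and> (\<forall>x\<in>K. \<forall>y\<in>K. x \<noteq> y \<longrightarrow> {x, y} \<in> E)"

definition num_cliques :: "'a set \<Rightarrow> 'a set set \<Rightarrow> nat \<Rightarrow> nat" where
  "num_cliques V E t = card {K. is_clique V E K \<and> card K = t}"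

(* Cliques need not be maximal, so {v} is always a candidate and the value is
   at least 1 for every vertex v of a finite graph. *)
definition vertex_clique_order :: "'a set \<Rightarrow> 'a set set \<Rightarrow> 'a \<Rightarrow> nat" where
  "vertex_clique_order V E v = Max {card K | K. is_clique V E K \<and> v \<in> K}"

(* The parts are nonempty; their number is arbitrary, so an edgeless graph is
   complete multipartite with a single part (and the graph without vertices has none). *)
definition complete_multipartite_with_parts ::
    "'a set \<Rightarrow> 'a set set \<Rightarrow> 'a set set \<Rightarrow> bool" where
  "complete_multipartite_with_parts V E P \<longleftrightarrow>
     partition_on V P \<and>
     (\<forall>x\<in>V. \<forall>y\<in>V. {x, y} \<in> E \<longleftrightarrow> \<not> (\<exists>A\<in>P. x \<in> A \<and> y \<in> A))"

definition regular_complete_multipartite :: "'a set \<Rightarrow> 'a set set \<Rightarrow> bool" where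
  "regular_complete_multipartite V E \<longleftrightarrow>
     (\<exists>P. complete_multipartite_with_parts V E P \<and> (\<forall>A\<in>P. \<forall>B\<in>P. card A = card B))"

end

theory Submission
  imports Defs
begin

text \<open>
  Put nonnegative weights x of total 1 on the vertices and compare the t-clique polynomial, the sum
  over t-cliques K of the product of x over K, with the linear form whose coefficient at v is
  binomial(c(v), t) / c(v)^t; the uniform weights give the theorem. If two nonadjacent vertices
  carry weight, the difference of the two sides is affine along a transfer of weight between them,
  so x is a convex combination of weightings with smaller support. If the support is a clique of
  order k, then c(v) is at least k on it and Maclaurin's inequality applies.

  At equality the uniform weights are optimal. If neither {u, v} nor {v, w} lies in a t-clique but
  {u, w} does, then moving weight s from v to each of u and w changes the difference by a linear
  term plus a positive multiple of s^2, contradicting optimality for s or -s. Hence the graph is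
  complete multipartite, and the equality case of Maclaurin's inequality makes the parts equal.
\<close>

section \<open>Clique polynomials and elementary symmetric polynomials\<close>

definition family_poly :: "'a set set \<Rightarrow> ('a \<Rightarrow> real) \<Rightarrow> real" where
  "family_poly F x = (\<Sum>K\<in>F. \<Prod>v\<in>K. x v)"

text \<open>The elementary symmetric polynomial of degree \<open>t\<close>. It shares
  \<open>family_poly\<close> with the sum over t-cliques, so that for a weighting supported on a
  clique the two sums differ only by vanishing monomials.\<close>

abbreviation esym :: "'a set \<Rightarrow> nat \<Rightarrow> ('a \<Rightarrow> real) \<Rightarrow> real" where
  "esym A t x \<equiv> family_poly {K. K \<subseteq> A \<and> card K = t} x"

lemma esym_cong: "(\<And>v. v \<in> A \<Longrightarrow> x v = y v) \<Longrightarrow> esym A t x = esym A t y"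
  unfolding family_poly_def by (intro sum.cong prod.cong) auto

lemma esym_0: "finite A \<Longrightarrow> esym A 0 x = 1"
proof -
  assume "finite A"
  then have "{K. K \<subseteq> A \<and> card K = 0} = {{}}"
    by (auto dest: finite_subset)
  then show ?thesis by (simp add: family_poly_def)
qed

lemma esym_insert:
  assumes "finite B" "a \<notin> B"
  shows "esym (insert a B) (Suc s) x = esym B (Suc s) x + x a * esym B s x"
proof -
  let ?S = "\<lambda>s. {K. K \<subseteq> B \<and> card K = s}"
  have fin: "finite K" if "K \<subseteq> B" for K
    using that assms(1) finite_subset by blast
  have finS: "finite (?S s)" for s
    using assms(1) by simp
  have eq: "{K. K \<subseteq> insert a B \<and> card K = Suc s} = ?S (Suc s) \<union> insert a ` ?S s"
  proof (intro equalityI subsetI)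
    fix K assume K: "K \<in> {K. K \<subseteq> insert a B \<and> card K = Suc s}"
    show "K \<in> ?S (Suc s) \<union> insert a ` ?S s"
    proof (cases "a \<in> K")
      case True
      then have "K = insert a (K - {a})" "K - {a} \<in> ?S s"
        using K by auto
      then show ?thesis by blast
    qed (use K in auto)
  qed (use assms fin in \<open>auto simp: card_insert_if\<close>)
  have inj: "inj_on (insert a) (?S s)"
    using assms(2) by (auto simp: inj_on_def)
  have "esym (insert a B) (Suc s) x
      = (\<Sum>K\<in>?S (Suc s). \<Prod>v\<in>K. x v) + (\<Sum>K\<in>insert a ` ?S s. \<Prod>v\<in>K. x v)"
    unfolding family_poly_def eq
    by (rule sum.union_disjoint) (use finS assms(2) in auto)
  also have "(\<Sum>K\<in>insert a ` ?S s. \<Prod>v\<in>K. x v) = (\<Sum>K\<in>?S s. x a * (\<Prod>v\<in>K. x v))"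
    unfolding sum.reindex[OF inj] o_def
    by (rule sum.cong) (use fin assms(2) in \<open>auto intro!: prod.insert\<close>)
  finally show ?thesis
    by (simp add: family_poly_def sum_distrib_left)
qed

lemma esym_1: "finite A \<Longrightarrow> esym A (Suc 0) x = sum x A"
proof (induction rule: finite_induct)
  case empty
  have "{K. K = {} \<and> card K = Suc 0} = ({} :: 'a set set)" by auto
  then show ?case by (simp add: family_poly_def)
qed (simp_all add: esym_insert esym_0)

lemma esym_const:
  assumes "finite A" "\<And>v. v \<in> A \<Longrightarrow> x v = c"
  shows "esym A t x = real (card A choose t) * c ^ t"
proof -
  have "esym A t x = (\<Sum>K\<in>{K. K \<subseteq> A \<and> card K = t}. c ^ t)"
    unfolding family_poly_def
  proof (rule sum.cong)
    fix K assume "K \<in> {K. K \<subseteq> A \<and> card K = t}"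
    then have "(\<Prod>v\<in>K. x v) = (\<Prod>v\<in>K. c)"
      using assms(2) by (intro prod.cong) auto
    then show "(\<Prod>v\<in>K. x v) = c ^ t"
      using \<open>K \<in> _\<close> by simp
  qed simp
  then show ?thesis by (simp add: n_subsets[OF assms(1)])
qed

lemma esym_nonneg: "(\<And>v. v \<in> A \<Longrightarrow> x v \<ge> 0) \<Longrightarrow> esym A t x \<ge> 0"
  unfolding family_poly_def by (intro sum_nonneg prod_nonneg) auto

lemma esym_pos:
  assumes "finite A" "\<And>v. v \<in> A \<Longrightarrow> x v > 0" "t \<le> card A"
  shows "esym A t x > 0"
proof -
  obtain K where "K \<subseteq> A" "card K = t"
    using assms(3) obtain_subset_with_card_n by metis
  then have "{K. K \<subseteq> A \<and> card K = t} \<noteq> {}" by auto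
  then show ?thesis
    unfolding family_poly_def
    using assms by (intro sum_pos prod_pos) auto
qed

section \<open>Maclaurin's inequality by smoothing\<close>

lemma sum_two_points:
  fixes x :: "'a \<Rightarrow> real"
  assumes "finite A" "i \<in> A" "j \<in> A" "i \<noteq> j"
  shows "sum x A = x i + x j + sum x (A - {i, j})"
proof -
  have "A = insert i (insert j (A - {i, j}))" using assms by auto
  then have "sum x A = sum x (insert i (insert j (A - {i, j})))" by simp
  then show ?thesis using assms by simp
qed

text \<open>As a polynomial in the entries at \<open>i\<close> and \<open>j\<close>,
  \<open>esym A t\<close> depends only on their sum and their product. Fixing the sum leaves the
  change of the product, whose coefficient is the symmetric polynomial of degree
  \<open>t - 2\<close> in the other entries.\<close>

lemma esym_smooth:
  assumes "finite A" "i \<in> A" "j \<in> A" "i \<noteq> j" "p + q = x i + x j" "t \<ge> 2"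
  shows "esym A t (x(i := p, j := q)) - esym A t x
    = (p * q - x i * x j) * esym (A - {i, j}) (t - 2) x"
proof -
  obtain s where t: "t = Suc (Suc s)"
    using assms(6) by (metis add_2_eq_Suc le_Suc_ex)
  let ?B = "A - {i, j}"
  have A: "A = insert i (insert j ?B)" using assms by auto
  have expand: "esym A t y = esym ?B t y + (y i + y j) * esym ?B (Suc s) y + y i * y j * esym ?B s y"
    for y :: "'a \<Rightarrow> real"
    by (subst A) (use assms(1,4) in \<open>simp add: t esym_insert algebra_simps\<close>)
  have cong: "esym ?B r (x(i := p, j := q)) = esym ?B r x" for r
    by (rule esym_cong) auto
  show ?thesis
    unfolding expand cong using assms(4,5) by (simp add: t algebra_simps)
qed

text \<open>An entry below the mean and one above it are moved towards each other with their sum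
  kept. Their product does not decrease, so neither does \<open>esym\<close>. The induction is on
  the number of entries different from the mean, and at a constant weighting both sides
  agree.\<close>

theorem maclaurin:
  assumes "finite A" "\<And>v. v \<in> A \<Longrightarrow> x v \<ge> 0"
  shows "esym A t x \<le> real (card A choose t) * (sum x A / real (card A)) ^ t"
proof -
  consider "t = 0" | "t = 1" | "t \<ge> 2" by linarith
  then show ?thesis
  proof cases
    case 1
    then show ?thesis by (simp add: esym_0 assms)
  next
    case 2
    then have "esym A t x = sum x A" by (simp add: esym_1 assms)
    then show ?thesis using assms 2 by (cases "A = {}") simp_all
  next
    case 3
    show ?thesis
      using assms(2)
    proof (induction "card {i \<in> A. x i \<noteq> sum x A / real (card A)}" arbitrary: x rule: less_induct)
      case less
      define m where "m = sum x A / real (card A)"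
      show ?case
      proof (cases "\<forall>v\<in>A. x v = m")
        case True
        then have "esym A t x = real (card A choose t) * m ^ t"
          by (intro esym_const assms(1)) auto
        then show ?thesis unfolding m_def by (rule eq_refl)
      next
        case False
        then have "A \<noteq> {}" by auto
        have sum0: "(\<Sum>v\<in>A. x v - m) = 0"
          using \<open>A \<noteq> {}\<close> assms(1) by (simp add: sum_subtractf m_def)
        obtain i where i: "i \<in> A" "x i < m"
        proof (rule ccontr)
          assume "\<not> thesis"
          then have "\<forall>v\<in>A. x v - m \<ge> 0" using that by force
          then show False using sum0 sum_nonneg_eq_0_iff[of A "\<lambda>v. x v - m"] assms(1) False by simp
        qed
        obtain j where j: "j \<in> A" "x j > m"
        proof (rule ccontr)
          assume "\<not> thesis"
          then have "\<forall>v\<in>A. m - x v \<ge> 0" using that by force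
          moreover have "(\<Sum>v\<in>A. m - x v) = 0"
            using sum0 by (simp add: sum_subtractf)
          ultimately show False using sum_nonneg_eq_0_iff[of A "\<lambda>v. m - x v"] assms(1) False by simp
        qed
        have ij: "i \<noteq> j" using i j by auto
        \<comment> \<open>Entry \<open>i\<close> becomes the mean exactly and \<open>j\<close>
          absorbs the difference, so at least one more entry is settled; \<open>j\<close> stays
          nonnegative because \<open>x j\<close> exceeds \<open>m\<close>.\<close>
        define y where "y = x(i := m, j := x i + x j - m)"
        have sumy: "sum y A = sum x A"
          using sum_two_points[OF assms(1) i(1) j(1) ij, of x] sum_two_points[OF assms(1) i(1) j(1) ij, of y] ij
          by (simp add: y_def)
        have nonneg: "y v \<ge> 0" if "v \<in> A" for v
          using less.prems[OF that] less.prems[OF i(1)] i j by (auto simp: y_def)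
        have "{v \<in> A. y v \<noteq> m} \<subseteq> {v \<in> A. x v \<noteq> m} - {i}"
          using i j ij by (auto simp: y_def)
        also have "\<dots> \<subset> {v \<in> A. x v \<noteq> m}" using i by auto
        finally have "card {v \<in> A. y v \<noteq> m} < card {v \<in> A. x v \<noteq> m}"
          using assms(1) by (intro psubset_card_mono) auto
        then have bound: "esym A t y \<le> real (card A choose t) * m ^ t"
          using less.hyps[of y] nonneg by (simp add: m_def sumy)
        have "esym A t y - esym A t x = (m * (x i + x j - m) - x i * x j) * esym (A - {i, j}) (t - 2) x"
          unfolding y_def using 3 by (intro esym_smooth assms i j ij) auto
        moreover have "m * (x i + x j - m) - x i * x j = (m - x i) * (x j - m)"
          by (simp add: algebra_simps)
        moreover have "(m - x i) * (x j - m) * esym (A - {i, j}) (t - 2) x \<ge> 0"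
          using i j less.prems by (intro mult_nonneg_nonneg esym_nonneg) auto
        ultimately show ?thesis using bound by (simp add: m_def)
      qed
    qed
  qed
qed

text \<open>Averaging two different entries strictly increases their product, and its coefficient
  \<open>esym (A - {i, j}) (t - 2) x\<close> is positive because enough positive entries remain. The
  averaged weighting still obeys \<open>maclaurin\<close>.\<close>

theorem maclaurin_strict:
  assumes "finite A" "\<And>v. v \<in> A \<Longrightarrow> x v > 0" "2 \<le> t" "t \<le> card A"
    and "i \<in> A" "j \<in> A" "x i \<noteq> x j"
  shows "esym A t x < real (card A choose t) * (sum x A / real (card A)) ^ t"
proof -
  have ij: "i \<noteq> j" using assms by auto
  define m where "m = (x i + x j) / 2"
  define y where "y = x(i := m, j := m)"
  have sumy: "sum y A = sum x A"
    using sum_two_points[OF assms(1,5,6) ij, of x] sum_two_points[OF assms(1,5,6) ij, of y] ij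
    by (simp add: y_def m_def)
  have "y v \<ge> 0" if "v \<in> A" for v
    using assms(2)[OF that] assms(2)[OF assms(5)] assms(2)[OF assms(6)] by (auto simp: y_def m_def)
  then have bound: "esym A t y \<le> real (card A choose t) * (sum x A / real (card A)) ^ t"
    using maclaurin[OF assms(1), of y t] by (simp add: sumy)
  have "esym A t y - esym A t x = (m * m - x i * x j) * esym (A - {i, j}) (t - 2) x"
    unfolding y_def using assms ij by (intro esym_smooth) (auto simp: m_def)
  moreover have "m * m - x i * x j = ((x i - x j) / 2)\<^sup>2"
    by (simp add: m_def power2_eq_square field_simps)
  moreover have "esym (A - {i, j}) (t - 2) x > 0"
    using assms ij by (intro esym_pos) (auto simp: card_Diff_subset)
  ultimately show ?thesis using bound assms(7) by (smt (verit) mult_pos_pos zero_less_power2 divide_eq_0_iff)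
qed

text \<open>Apply Maclaurin to the 0/1 weights selecting k of c points.\<close>
lemma binomial_div_power_mono:
  assumes "0 < k" "k \<le> c"
  shows "real (k choose t) / real k ^ t \<le> real (c choose t) / real c ^ t"
proof -
  let ?x = "\<lambda>i. if i < k then 1 else 0 :: real"
  have "real (k choose t) = esym {..<k} t ?x"
    by (subst esym_const[where c = 1]) auto
  also have "\<dots> \<le> esym {..<c} t ?x"
    unfolding family_poly_def using assms(2)
    by (intro sum_mono2) (auto simp: prod_nonneg)
  also have "\<dots> \<le> real (c choose t) * (sum ?x {..<c} / real c) ^ t"
    using maclaurin[of "{..<c}" ?x t] by simp
  also have "sum ?x {..<c} = real k"
  proof -
    have "{..<c} \<inter> {i. i < k} = {..<k}" using assms(2) by auto
    then show ?thesis by (simp add: sum.If_cases)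
  qed
  finally show ?thesis using assms by (simp add: field_simps power_divide)
qed

section \<open>Partial transversals of a partition\<close>

text \<open>These are the cliques of a complete multipartite graph with parts \<open>P\<close>. The
  notion mentions no graph, so it also serves for a partition not yet known to consist of the parts
  of one.\<close>

definition partial_transversal :: "'a set set \<Rightarrow> 'a set \<Rightarrow> bool" where
  "partial_transversal P K \<longleftrightarrow> K \<subseteq> \<Union>P \<and> (\<forall>A\<in>P. \<forall>x\<in>A \<inter> K. \<forall>y\<in>A \<inter> K. x = y)"

lemma card_partial_transversal_le:
  assumes "finite P" "partial_transversal P K"
  shows "card K \<le> card P"
proof -
  have "\<forall>v\<in>K. \<exists>A. A \<in> P \<and> v \<in> A"
    using assms(2) unfolding partial_transversal_def by auto
  then obtain g where g: "\<forall>v\<in>K. g v \<in> P \<and> v \<in> g v" by metis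
  have "inj_on g K"
    using g assms(2) unfolding partial_transversal_def inj_on_def by (metis IntI)
  then show ?thesis
    using g assms(1) by (intro card_inj_on_le[of g]) auto
qed

text \<open>Since blocks are disjoint, a representative of \<open>B\<close> that lies in
  \<open>A\<close> forces \<open>A = B\<close>; all three claims follow from this.\<close>

lemma partial_transversal_image:
  assumes "partition_on V P" "Q \<subseteq> P" "\<And>A. A \<in> Q \<Longrightarrow> f A \<in> A"
  shows "partial_transversal P (f ` Q)" and "inj_on f Q"
    and "\<And>A. A \<in> Q \<Longrightarrow> A \<inter> f ` Q = {f A}"
proof -
  have same: "A = B" if "A \<in> P" "B \<in> Q" "f B \<in> A" for A B
    using that assms partition_onD2[OF assms(1)] by (metis IntI disjointD empty_iff subsetD)
  then show int: "A \<inter> f ` Q = {f A}" if "A \<in> Q" for A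
    using that assms(2,3) by blast
  show "partial_transversal P (f ` Q)"
    unfolding partial_transversal_def using assms(2,3) same by blast
  show "inj_on f Q"
    using assms(2,3) same by (metis inj_onI subsetD)
qed

lemma transversal_through:
  assumes "partition_on V P" "v \<in> V"
  obtains T where "partial_transversal P T" "v \<in> T" "card T = card P"
proof -
  \<comment> \<open>The block of \<open>v\<close> is represented by \<open>v\<close> itself, every
    other block by an arbitrary element.\<close>
  define f where "f A = (if v \<in> A then v else SOME w. w \<in> A)" for A
  have f: "f A \<in> A" if "A \<in> P" for A
    using that partition_onD3[OF assms(1)] by (auto simp: f_def some_in_eq)
  obtain A where "A \<in> P" "v \<in> A"
    using assms partition_onD1 by blast
  then have "v \<in> f ` P" by (force simp: f_def)
  moreover note partial_transversal_image[OF assms(1) subset_refl f]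
  ultimately show ?thesis
    using that[of "f ` P"] by (simp add: card_image)
qed

text \<open>A partial transversal of size \<open>t\<close> amounts to a set \<open>Q\<close> of
  \<open>t\<close> blocks together with one element from each. Taking the choice functions from
  \<open>PiE\<close> fixes their values outside \<open>Q\<close>, which makes the correspondence
  bijective.\<close>

lemma card_partial_transversals:
  assumes "finite V" "partition_on V P"
  shows "real (card {K. partial_transversal P K \<and> card K = t}) = esym P t (\<lambda>A. real (card A))"
proof -
  let ?Q = "{Q. Q \<subseteq> P \<and> card Q = t}"
  have finP: "finite P" using finite_elements[OF assms] .
  have finA: "finite A" if "A \<in> P" for A
    using that assms partition_onD1 by (metis Sup_upper finite_subset)
  have "bij_betw (\<lambda>(Q, f). f ` Q) (SIGMA Q:?Q. PiE Q (\<lambda>A. A)) {K. partial_transversal P K \<and> card K = t}"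
    unfolding bij_betw_def
  proof (intro conjI equalityI subsetI)
    show "inj_on (\<lambda>(Q, f). f ` Q) (SIGMA Q:?Q. PiE Q (\<lambda>A. A))"
    proof (rule inj_onI, clarsimp)
      fix Q f Q' f'
      assume Q: "Q \<subseteq> P" "Q' \<subseteq> P" and f: "f \<in> PiE Q (\<lambda>A. A)" "f' \<in> PiE Q' (\<lambda>A. A)"
        and eq: "f ` Q = f' ` Q'"
      have fA: "\<And>A. A \<in> Q \<Longrightarrow> f A \<in> A" "\<And>A. A \<in> Q' \<Longrightarrow> f' A \<in> A"
        using f by (auto simp: PiE_mem)
      \<comment> \<open>The image of a choice function determines which blocks were used; applied in
        both directions this gives \<open>Q = Q'\<close>.\<close>
      have sub: "R \<subseteq> S" if "R \<subseteq> P" "S \<subseteq> P" "\<And>A. A \<in> R \<Longrightarrow> g A \<in> A" "\<And>A. A \<in> S \<Longrightarrow> h A \<in> A"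
        and img: "g ` R = h ` S" for R S and g h :: "'a set \<Rightarrow> 'a"
      proof
        fix A assume A: "A \<in> R"
        then obtain B where B: "B \<in> S" "g A = h B" using img by blast
        then have "g A \<in> A" "g A \<in> B" using that(3)[OF A] that(4)[OF B(1)] by auto
        then have "A = B"
          using A B that partition_onD2[OF assms(2)] by (metis IntI disjointD empty_iff subsetD)
        then show "A \<in> S" using B by simp
      qed
      have QQ: "Q = Q'"
        using sub[OF Q fA eq] sub[OF Q(2,1) fA(2,1) eq[symmetric]] by blast
      moreover have "f = f'"
      proof (rule PiE_ext[OF f(1)])
        show "f' \<in> PiE Q (\<lambda>A. A)" using f QQ by simp
        fix A assume A: "A \<in> Q"
        have "{f A} = {f' A}"
          using partial_transversal_image(3)[OF assms(2) Q(1) fA(1) A]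
            partial_transversal_image(3)[OF assms(2) Q(2) fA(2)] A QQ eq by metis
        then show "f A = f' A" by simp
      qed
      ultimately show "Q = Q' \<and> f = f'" by simp
    qed
  next
    fix K assume "K \<in> (\<lambda>(Q, f). f ` Q) ` (SIGMA Q:?Q. PiE Q (\<lambda>A. A))"
    then obtain Q f where K: "K = f ` Q" "Q \<subseteq> P" "card Q = t" "f \<in> PiE Q (\<lambda>A. A)"
      by auto
    then have "\<And>A. A \<in> Q \<Longrightarrow> f A \<in> A" by (auto simp: PiE_mem)
    then show "K \<in> {K. partial_transversal P K \<and> card K = t}"
      using K partial_transversal_image(1,2)[OF assms(2) K(2)] by (simp add: card_image)
  next
    fix K assume K: "K \<in> {K. partial_transversal P K \<and> card K = t}"
    \<comment> \<open>The inverse map: \<open>Q\<close> collects the blocks that \<open>K\<close>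
      meets, and \<open>f\<close> picks the single element of \<open>K\<close> in each.\<close>
    define Q where "Q = {A \<in> P. A \<inter> K \<noteq> {}}"
    define f where "f = restrict (\<lambda>A. SOME v. v \<in> A \<inter> K) Q"
    have f: "f A \<in> A \<inter> K" if "A \<in> Q" for A
    proof -
      have "(SOME v. v \<in> A \<inter> K) \<in> A \<inter> K"
        using that by (intro someI_ex[of "\<lambda>v. v \<in> A \<inter> K"]) (auto simp: Q_def)
      then show ?thesis using that by (simp add: f_def)
    qed
    have img: "f ` Q = K"
    proof (intro equalityI subsetI)
      fix v assume v: "v \<in> K"
      then obtain A where A: "A \<in> P" "v \<in> A" using K unfolding partial_transversal_def by blast
      then have "A \<in> Q" using v by (auto simp: Q_def)
      then have "f A = v"
        using f[of A] A v K unfolding partial_transversal_def by blast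
      then show "v \<in> f ` Q" using \<open>A \<in> Q\<close> by blast
    qed (use f in auto)
    have "inj_on f Q"
      by (rule partial_transversal_image(2)[OF assms(2)]) (use f in \<open>auto simp: Q_def\<close>)
    then have "card Q = t" using K img card_image by fastforce
    moreover have "f \<in> PiE Q (\<lambda>A. A)"
      using f by (auto simp: f_def)
    moreover have "Q \<subseteq> P" by (auto simp: Q_def)
    ultimately have "(Q, f) \<in> (SIGMA Q:?Q. PiE Q (\<lambda>A. A))" by auto
    then show "K \<in> (\<lambda>(Q, f). f ` Q) ` (SIGMA Q:?Q. PiE Q (\<lambda>A. A))"
      by (rule rev_image_eqI) (simp add: img)
  qed
  then have "card {K. partial_transversal P K \<and> card K = t} = card (SIGMA Q:?Q. PiE Q (\<lambda>A. A))"
    by (simp add: bij_betw_same_card)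
  also have "\<dots> = (\<Sum>Q\<in>?Q. card (PiE Q (\<lambda>A. A)))"
    using finP finA by (intro card_SigmaI) (auto intro!: finite_PiE dest: finite_subset)
  also have "\<dots> = (\<Sum>Q\<in>?Q. \<Prod>A\<in>Q. card A)"
    using finP by (intro sum.cong card_PiE) (auto dest: finite_subset)
  finally show ?thesis by (simp add: family_poly_def)
qed

section \<open>Cliques and clique orders of vertices\<close>

lemma multipartite_is_clique_iff:
  assumes "complete_multipartite_with_parts V E P"
  shows "is_clique V E K \<longleftrightarrow> partial_transversal P K"
proof -
  have "\<Union>P = V"
    using assms unfolding complete_multipartite_with_parts_def by (simp add: partition_on_def)
  moreover have "(x \<noteq> y \<longrightarrow> {x, y} \<in> E) \<longleftrightarrow> (\<forall>A\<in>P. x \<in> A \<longrightarrow> y \<in> A \<longrightarrow> x = y)"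
    if "x \<in> V" "y \<in> V" for x y
    using assms that unfolding complete_multipartite_with_parts_def by auto
  then have "(\<forall>x\<in>K. \<forall>y\<in>K. x \<noteq> y \<longrightarrow> {x, y} \<in> E)
      \<longleftrightarrow> (\<forall>x\<in>K. \<forall>y\<in>K. \<forall>A\<in>P. x \<in> A \<longrightarrow> y \<in> A \<longrightarrow> x = y)" if "K \<subseteq> V"
    using that by (meson subsetD)
  ultimately show ?thesis
    unfolding is_clique_def partial_transversal_def by blast
qed

lemma finite_clique_cards:
  assumes "finite V"
  shows "finite {card K | K. is_clique V E K \<and> v \<in> K}"
proof -
  have "{card K | K. is_clique V E K \<and> v \<in> K} \<subseteq> card ` Pow V"
    by (auto simp: is_clique_def)
  then show ?thesis using assms finite_subset by blast
qed

lemma card_le_vertex_clique_order: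
  assumes "finite V" "is_clique V E K" "v \<in> K"
  shows "card K \<le> vertex_clique_order V E v"
  unfolding vertex_clique_order_def
  using assms finite_clique_cards by (intro Max_ge) auto

lemma vertex_clique_order_attained:
  assumes "finite V" "v \<in> V"
  obtains K where "is_clique V E K" "v \<in> K" "card K = vertex_clique_order V E v"
proof -
  let ?C = "{card K | K. is_clique V E K \<and> v \<in> K}"
  have "is_clique V E {v}" using assms by (auto simp: is_clique_def)
  then have "?C \<noteq> {}" by blast
  then have "Max ?C \<in> ?C" using finite_clique_cards[OF assms(1)] by (intro Max_in) auto
  then show ?thesis using that unfolding vertex_clique_order_def by force
qed

lemma is_clique_subset: "is_clique V E K \<Longrightarrow> L \<subseteq> K \<Longrightarrow> is_clique V E L"
  unfolding is_clique_def by blast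

text \<open>A clique has at most one vertex in each part, and a full transversal through
  \<open>v\<close> attains this bound.\<close>

lemma multipartite_vertex_clique_order:
  assumes "finite V" "complete_multipartite_with_parts V E P" "v \<in> V"
  shows "vertex_clique_order V E v = card P"
proof (rule antisym)
  have P: "partition_on V P" using assms(2) by (simp add: complete_multipartite_with_parts_def)
  obtain K where "is_clique V E K" "card K = vertex_clique_order V E v"
    using vertex_clique_order_attained[OF assms(1,3)] by metis
  then show "vertex_clique_order V E v \<le> card P"
    using card_partial_transversal_le[OF finite_elements[OF assms(1) P]]
      multipartite_is_clique_iff[OF assms(2)] by metis
  obtain T where "partial_transversal P T" "v \<in> T" "card T = card P"
    using transversal_through[OF P assms(3)] .
  then show "card P \<le> vertex_clique_order V E v"
    using card_le_vertex_clique_order[OF assms(1)] multipartite_is_clique_iff[OF assms(2)] by metis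
qed

section \<open>The weighted inequality\<close>

definition cliques :: "'a set \<Rightarrow> 'a set set \<Rightarrow> nat \<Rightarrow> 'a set set" where
  "cliques V E t = {K. is_clique V E K \<and> card K = t}"

text \<open>With c the clique order of \<open>v\<close>, this is the value of the t-clique
  polynomial of a clique on c vertices at the uniform weights 1/c.\<close>

definition zykov_weight :: "'a set \<Rightarrow> 'a set set \<Rightarrow> nat \<Rightarrow> 'a \<Rightarrow> real" where
  "zykov_weight V E t v
    = real (vertex_clique_order V E v choose t) / real (vertex_clique_order V E v) ^ t"

lemma finite_cliques: "finite V \<Longrightarrow> finite (cliques V E t)"
  by (rule finite_subset[of _ "Pow V"]) (auto simp: cliques_def is_clique_def)

lemma finite_member_cliques: "finite V \<Longrightarrow> K \<in> cliques V E t \<Longrightarrow> finite K"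
  by (auto simp: cliques_def is_clique_def intro: finite_subset)

text \<open>No monomial contains both \<open>u\<close> and \<open>v\<close>, so the polynomial is
  affine along transfers between them. The weighting \<open>x\<close> is the convex combination of
  the two extreme transfers with coefficients proportional to \<open>x u\<close> and
  \<open>x v\<close>; the identity is stated with the denominator cleared.\<close>

lemma family_poly_collapse:
  assumes "\<And>K. K \<in> F \<Longrightarrow> finite K" "\<And>K. K \<in> F \<Longrightarrow> \<not> (u \<in> K \<and> v \<in> K)"
    and "u \<noteq> v" "x u + x v \<noteq> 0"
  shows "(x u + x v) * family_poly F x
    = x u * family_poly F (x(u := x u + x v, v := 0)) + x v * family_poly F (x(u := 0, v := x u + x v))"
  unfolding family_poly_def sum_distrib_left sum.distrib[symmetric]
proof (rule sum.cong[OF refl])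
  fix K assume K: "K \<in> F"
  have cong: "prod (x(u := a, v := b)) (K - {u, v}) = prod x (K - {u, v})" for a b
    by (rule prod.cong) auto
  consider (u) "u \<in> K" "K - {u} = K - {u, v}" | (v) "v \<in> K" "K - {v} = K - {u, v}"
    | (none) "K = K - {u, v}"
    using assms(2)[OF K] by blast
  then show "(x u + x v) * prod x K
    = x u * prod (x(u := x u + x v, v := 0)) K + x v * prod (x(u := 0, v := x u + x v)) K"
  proof cases
    case u
    note s = prod.remove[OF assms(1)[OF K] u(1), unfolded u(2)]
    show ?thesis unfolding s[of x] s[of "x(u := _, v := _)"] cong using assms(3) by simp
  next
    case v
    note s = prod.remove[OF assms(1)[OF K] v(1), unfolded v(2)]
    show ?thesis unfolding s[of x] s[of "x(u := _, v := _)"] cong using assms(3) by simp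
  next
    case none
    have "prod (x(u := a, v := b)) K = prod x K" for a b
      using none cong by metis
    then show ?thesis by (simp add: algebra_simps)
  qed
qed

text \<open>General weights are what the induction on the support size requires, since collapsing
  destroys uniformity. The clique orders remain those of the whole graph, so the linear form is the
  same throughout.\<close>

theorem weighted_zykov:
  assumes "finite V" "\<And>v. v \<in> V \<Longrightarrow> x v \<ge> 0" "sum x V = 1"
  shows "family_poly (cliques V E t) x \<le> (\<Sum>v\<in>V. zykov_weight V E t v * x v)"
  using assms(2,3)
proof (induction "card {v \<in> V. x v > 0}" arbitrary: x rule: less_induct)
  case less
  define S where "S = {v \<in> V. x v > 0}"
  have SV: "S \<subseteq> V" and finS: "finite S" using assms(1) by (auto simp: S_def)
  have outside: "x v = 0" if "v \<in> V - S" for v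
    using that less.prems(1)[of v] unfolding S_def by fastforce
  show ?case
  proof (cases "is_clique V E S")
    case True
    have sumS: "sum x S = 1"
      using sum.mono_neutral_left[OF assms(1) SV, of x] outside less.prems(2) by simp
    then have "S \<noteq> {}" by auto
    then have k: "card S > 0" using finS by (simp add: card_gt_0_iff)
    \<comment> \<open>Every t-subset of the clique \<open>S\<close> is a t-clique, and a t-clique
      leaving \<open>S\<close> contains a vertex of weight 0.\<close>
    have "family_poly (cliques V E t) x = esym S t x"
      unfolding family_poly_def
    proof (rule sum.mono_neutral_right)
      show "finite (cliques V E t)" using assms(1) by (rule finite_cliques)
      show "{K. K \<subseteq> S \<and> card K = t} \<subseteq> cliques V E t"
        using True is_clique_subset by (auto simp: cliques_def)
      show "\<forall>K\<in>cliques V E t - {K. K \<subseteq> S \<and> card K = t}. prod x K = 0"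
      proof
        fix K assume K: "K \<in> cliques V E t - {K. K \<subseteq> S \<and> card K = t}"
        then obtain v where "v \<in> K" "v \<in> V - S" by (auto simp: cliques_def is_clique_def)
        then show "prod x K = 0"
          using K finite_member_cliques[OF assms(1)] outside by (intro prod_zero bexI[of _ v]) auto
      qed
    qed
    also have "\<dots> \<le> real (card S choose t) * (sum x S / real (card S)) ^ t"
      by (rule maclaurin[OF finS]) (simp add: S_def)
    also have "\<dots> = (\<Sum>v\<in>S. real (card S choose t) / real (card S) ^ t * x v)"
      by (simp only: sum_distrib_left[symmetric] sumS) (simp add: power_divide)
    also have "\<dots> \<le> (\<Sum>v\<in>S. zykov_weight V E t v * x v)"
    proof (rule sum_mono)
      fix v assume v: "v \<in> S"
      show "real (card S choose t) / real (card S) ^ t * x v \<le> zykov_weight V E t v * x v"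
        unfolding zykov_weight_def
        using binomial_div_power_mono[OF k card_le_vertex_clique_order[OF assms(1) True v], of t] v
        by (intro mult_right_mono) (auto simp: S_def)
    qed
    also have "\<dots> = (\<Sum>v\<in>V. zykov_weight V E t v * x v)"
      using outside by (intro sum.mono_neutral_left assms(1) SV) simp
    finally show ?thesis .
  next
    case False
    then obtain u v where uv: "u \<in> S" "v \<in> S" "u \<noteq> v" "{u, v} \<notin> E"
      unfolding is_clique_def S_def by auto
    have uvV: "u \<in> V" "v \<in> V" and pos: "x u > 0" "x v > 0" using uv by (auto simp: S_def)
    let ?L = "\<lambda>x. \<Sum>v\<in>V. zykov_weight V E t v * x v"
    let ?y = "x(u := x u + x v, v := 0)" and ?z = "x(u := 0, v := x u + x v)"
    \<comment> \<open>Covers both extreme transfers at once: one of \<open>u\<close>,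
      \<open>v\<close> drops to weight 0 and leaves the support.\<close>
    have IH: "family_poly (cliques V E t) (x(u := a, v := b)) \<le> ?L (x(u := a, v := b))"
      if ab: "a \<ge> 0" "b \<ge> 0" "a + b = x u + x v" "a = 0 \<or> b = 0" for a b
    proof (rule less.hyps)
      let ?w = "x(u := a, v := b)"
      show "?w i \<ge> 0" if "i \<in> V" for i using that ab less.prems(1) by auto
      show "sum ?w V = 1"
        using less.prems(2) sum_two_points[OF assms(1) uvV uv(3), of x]
          sum_two_points[OF assms(1) uvV uv(3), of ?w] uv(3) ab(3) by simp
      have "{i \<in> V. ?w i > 0} \<subseteq> S" "{i \<in> V. ?w i > 0} \<noteq> S"
        using uv pos ab by (auto simp: S_def)
      then show "card {i \<in> V. ?w i > 0} < card {i \<in> V. x i > 0}"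
        using finS unfolding S_def[symmetric] by (intro psubset_card_mono) auto
    qed
    have "(x u + x v) * family_poly (cliques V E t) x
      = x u * family_poly (cliques V E t) ?y + x v * family_poly (cliques V E t) ?z"
      using uv pos finite_member_cliques[OF assms(1)]
      by (intro family_poly_collapse) (auto simp: cliques_def is_clique_def)
    also have "\<dots> \<le> x u * ?L ?y + x v * ?L ?z"
      using pos by (intro add_mono mult_left_mono IH) auto
    also have "\<dots> = (x u + x v) * ?L x"
      using sum_two_points[OF assms(1) uvV uv(3), of "\<lambda>i. zykov_weight V E t i * x i"]
        sum_two_points[OF assms(1) uvV uv(3), of "\<lambda>i. zykov_weight V E t i * ?y i"]
        sum_two_points[OF assms(1) uvV uv(3), of "\<lambda>i. zykov_weight V E t i * ?z i"] uv(3)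
      by (simp add: algebra_simps)
    finally show ?thesis using pos by simp
  qed
qed

section \<open>Equality forces a complete multipartite graph\<close>

lemma family_poly_const:
  assumes "\<And>K. K \<in> F \<Longrightarrow> card K = t"
  shows "family_poly F (\<lambda>_. c) = real (card F) * c ^ t"
  unfolding family_poly_def using assms by simp

text \<open>Adding the values at \<open>s\<close> and \<open>-s\<close> cancels all terms linear in
  \<open>s\<close>. A member that does not contain both \<open>u\<close> and \<open>w\<close>
  contains at most one of the three vertices, so it contributes no change. A member containing both
  gains \<open>2 * s\<^sup>2\<close> times a power of \<open>c\<close>, and \<open>L\<close> is such
  a member.\<close>

lemma family_poly_perturb:
  fixes c s :: real
  assumes "finite F" "\<And>K. K \<in> F \<Longrightarrow> finite K"
    and "\<And>K. K \<in> F \<Longrightarrow> \<not> (u \<in> K \<and> v \<in> K)" "\<And>K. K \<in> F \<Longrightarrow> \<not> (v \<in> K \<and> w \<in> K)"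
    and "L \<in> F" "u \<in> L" "w \<in> L" "u \<noteq> w" "u \<noteq> v" "v \<noteq> w" "c > 0" "s \<noteq> 0"
  defines "y \<equiv> \<lambda>s. (\<lambda>_. c)(u := c + s, w := c + s, v := c - 2 * s)"
  shows "family_poly F (y s) + family_poly F (y (- s)) > 2 * family_poly F (\<lambda>_. c)"
proof -
  have cong: "prod (y s) (K - {u, v, w}) = prod (\<lambda>_. c) (K - {u, v, w})" for s K
    by (rule prod.cong) (auto simp: y_def)
  have vals: "y s u = c + s" "y s w = c + s" "y s v = c - 2 * s" for s
    using assms by (auto simp: y_def)
  have both: "prod (y s) K + prod (y (- s)) K - 2 * prod (\<lambda>_. c) K = 2 * s\<^sup>2 * c ^ card (K - {u, v, w})"
    if K: "K \<in> F" "u \<in> K" "w \<in> K" for K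
  proof -
    have "K - {u} - {w} = K - {u, v, w}" using assms(3)[OF K(1)] K by auto
    then have s: "prod f K = f u * f w * prod f (K - {u, v, w})" for f :: "'a \<Rightarrow> real"
      using prod.remove[of K u f] prod.remove[of "K - {u}" w f] assms(2,8) K by simp
    show ?thesis
      unfolding s cong vals by (simp add: power2_eq_square algebra_simps)
  qed
  have single: "prod (y s) K + prod (y (- s)) K = 2 * prod (\<lambda>_. c) K"
    if K: "K \<in> F" "\<not> (u \<in> K \<and> w \<in> K)" for K
  proof (cases "K \<inter> {u, v, w} = {}")
    case True
    then have "K - {u, v, w} = K" by auto
    then show ?thesis using cong[of _ K] by simp
  next
    case False
    then obtain a where a: "a \<in> K" "a \<in> {u, v, w}" by auto
    then have "K - {a} = K - {u, v, w}" using assms(3,4)[OF K(1)] K by auto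
    then have s: "prod f K = f a * prod f (K - {u, v, w})" for f :: "'a \<Rightarrow> real"
      using prod.remove[of K a f] assms(2) K(1) a by simp
    have "y s a + y (- s) a = 2 * c" using a vals by auto
    then show ?thesis unfolding s cong by (metis distrib_right mult.assoc)
  qed
  have "(\<Sum>K\<in>F. 2 * prod (\<lambda>_. c) K) < (\<Sum>K\<in>F. prod (y s) K + prod (y (- s)) K)"
  proof (rule sum_strict_mono_ex1[OF assms(1)])
    have pos: "2 * s\<^sup>2 * c ^ n > 0" for n using assms by simp
    show "\<forall>K\<in>F. 2 * prod (\<lambda>_. c) K \<le> prod (y s) K + prod (y (- s)) K"
      using both single pos by (smt (verit))
    show "\<exists>K\<in>F. 2 * prod (\<lambda>_. c) K < prod (y s) K + prod (y (- s)) K"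
      using both[OF assms(5-7)] pos assms(5) by (smt (verit))
  qed
  then show ?thesis by (simp add: family_poly_def sum.distrib sum_distrib_left)
qed

text \<open>At equality, "in no common t-clique" is thus transitive. The perturbation controls only this
  weakening of nonadjacency; the two are identified later, once the classes are known.\<close>
lemma equality_imp_transitive:
  assumes "finite V" "V \<noteq> {}"
    and eq: "real (card (cliques V E t)) = real (card V) ^ (t - 1) * (\<Sum>v\<in>V. zykov_weight V E t v)"
    and "t \<ge> 1" "v \<in> V" "L \<in> cliques V E t" "u \<in> L" "w \<in> L" "u \<noteq> w"
  obtains K where "K \<in> cliques V E t" "u \<in> K" "v \<in> K" | K where "K \<in> cliques V E t" "v \<in> K" "w \<in> K"
proof (rule ccontr)
  assume "\<not> thesis"
  then have no: "\<And>K. K \<in> cliques V E t \<Longrightarrow> \<not> (u \<in> K \<and> v \<in> K)"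
    "\<And>K. K \<in> cliques V E t \<Longrightarrow> \<not> (v \<in> K \<and> w \<in> K)"
    using that by blast+
  have neq: "u \<noteq> v" "v \<noteq> w" using no assms by blast+
  have inV: "u \<in> V" "w \<in> V" using assms by (auto simp: cliques_def is_clique_def)
  define c where "c = 1 / real (card V)"
  have cpos: "c > 0" using assms(1,2) by (simp add: c_def card_gt_0_iff)
  define y where "y s = (\<lambda>_. c)(u := c + s, w := c + s, v := c - 2 * s)" for s
  let ?h = "zykov_weight V E t"
  have three: "sum f V = f u + f w + f v + sum f (V - {u, w} - {v})" for f :: "'a \<Rightarrow> real"
    using sum_two_points[OF assms(1) inV assms(9), of f] sum.remove[of "V - {u, w}" v f] assms neq by simp
  have sum1: "sum (\<lambda>_. c) V = 1" using assms(1,2) by (simp add: c_def)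
  have rest: "sum (\<lambda>i. g i * y s i) (V - {u, w} - {v}) = sum (\<lambda>i. g i * c) (V - {u, w} - {v})" for s g
    by (rule sum.cong) (auto simp: y_def)
  have vals: "y s u = c + s" "y s w = c + s" "y s v = c - 2 * s" for s
    using neq assms(9) by (auto simp: y_def)
  have sumy: "sum (y s) V = 1" for s
    using three[of "y s"] three[of "\<lambda>_. c"] rest[of "\<lambda>_. 1" s] sum1 vals by simp
  \<comment> \<open>The range of \<open>s\<close> is what keeps the weight \<open>c - 2 * s\<close>
    of \<open>v\<close>, and for negative \<open>s\<close> those of \<open>u\<close> and
    \<open>w\<close>, nonnegative.\<close>
  have le: "family_poly (cliques V E t) (y s) \<le> (\<Sum>i\<in>V. ?h i * y s i)" if "\<bar>s\<bar> \<le> c / 2" for s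
    by (rule weighted_zykov[OF assms(1) _ sumy]) (use that cpos in \<open>auto simp: y_def abs_le_iff\<close>)
  have "2 * family_poly (cliques V E t) (\<lambda>_. c)
      < family_poly (cliques V E t) (y (c / 2)) + family_poly (cliques V E t) (y (- (c / 2)))"
    unfolding y_def
    by (rule family_poly_perturb[OF finite_cliques[OF assms(1)] finite_member_cliques[OF assms(1)] no assms(6-9) neq cpos])
      (use cpos in auto)
  also have "\<dots> \<le> (\<Sum>i\<in>V. ?h i * y (c / 2) i) + (\<Sum>i\<in>V. ?h i * y (- (c / 2)) i)"
    using cpos by (intro add_mono le) auto
  \<comment> \<open>The two perturbations average to the uniform weighting, so the linear form sees
    no change.\<close>
  also have "\<dots> = 2 * (\<Sum>i\<in>V. ?h i * c)"
    unfolding three[of "\<lambda>i. ?h i * _ i"] three[of "\<lambda>i. ?h i * c"] rest vals by (simp add: algebra_simps)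
  finally have "real (card (cliques V E t)) * c ^ t < (\<Sum>i\<in>V. ?h i) * c"
    using family_poly_const[of "cliques V E t" t c]
    by (simp add: cliques_def sum_distrib_right)
  \<comment> \<open>This rescales the assumed equality to the uniform weights, where it contradicts
    the strict inequality just derived.\<close>
  moreover have "real (card V) ^ (t - 1) * c ^ t = c"
    using assms(1,2,4) by (cases t) (auto simp: c_def power_divide)
  ultimately show False
    unfolding eq by (metis less_irrefl mult.assoc mult.commute)
qed

text \<open>The parts are the classes of \<open>R\<close>. Unrelated vertices share a t-clique and
  are therefore adjacent; that related vertices are nonadjacent needs the existence of at least
  \<open>t\<close> classes.\<close>

lemma equality_imp_multipartite:
  assumes G: "finite_simple_graph V E" and t: "t \<ge> 2" and ne: "cliques V E t \<noteq> {}"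
    and eq: "real (card (cliques V E t)) = real (card V) ^ (t - 1) * (\<Sum>v\<in>V. zykov_weight V E t v)"
  obtains P where "complete_multipartite_with_parts V E P"
proof -
  have fin: "finite V" using G by (simp add: finite_simple_graph_def)
  \<comment> \<open>The disjunct \<open>u = v\<close> secures reflexivity: a vertex of a t-clique
    shares that clique with itself.\<close>
  define R where "R = {(u, v). u \<in> V \<and> v \<in> V \<and> (u = v \<or> (\<forall>K\<in>cliques V E t. \<not> (u \<in> K \<and> v \<in> K)))}"
  have Vne: "V \<noteq> {}" using ne t by (auto simp: cliques_def is_clique_def)
  have equiv: "equiv V R"
  proof (rule equivI)
    show "R \<subseteq> V \<times> V" by (auto simp: R_def)
    show "refl_on V R" by (auto simp: refl_on_def R_def)
    show "sym R" by (auto simp: sym_def R_def)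
    show "trans R"
    proof (rule transI)
      fix u v w assume uv: "(u, v) \<in> R" and vw: "(v, w) \<in> R"
      show "(u, w) \<in> R"
      proof (rule ccontr)
        assume uw: "(u, w) \<notin> R"
        then obtain L where L: "L \<in> cliques V E t" "u \<in> L" "w \<in> L" "u \<noteq> w"
          using uv vw by (auto simp: R_def)
        have "v \<in> V" "v \<noteq> u" "v \<noteq> w" using uv vw uw by (auto simp: R_def)
        then show False
          using equality_imp_transitive[OF fin Vne eq _ \<open>v \<in> V\<close> L] t uv vw
          by (auto simp: R_def)
      qed
    qed
  qed
  define P where "P = V // R"
  have part: "partition_on V P"
    unfolding P_def using equiv by (rule partition_on_quotient)
  have same: "(\<exists>A\<in>P. x \<in> A \<and> y \<in> A) \<longleftrightarrow> (x, y) \<in> R" for x y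
    unfolding P_def using equiv
    by (smt (verit) equiv_class_self Image_singleton_iff equiv_type mem_Sigma_iff quotientI quotient_eq_iff in_quotient_imp_in_rel subsetD empty_subsetI insert_subset)
  have adj: "{x, y} \<in> E" if "x \<in> V" "y \<in> V" "(x, y) \<notin> R" for x y
    using that by (auto simp: R_def cliques_def is_clique_def)
  have clique: "is_clique V E K" if "partial_transversal P K" for K
    unfolding is_clique_def
  proof (intro conjI ballI impI)
    show KV: "K \<subseteq> V" using that part by (simp add: partial_transversal_def partition_on_def)
    fix x y assume "x \<in> K" "y \<in> K" "x \<noteq> y"
    then show "{x, y} \<in> E"
      using that same[of x y] KV by (intro adj) (auto simp: partial_transversal_def)
  qed
  have trans: "partial_transversal P K" if "K \<in> cliques V E t" for K
    unfolding partial_transversal_def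
  proof (intro conjI ballI)
    show "K \<subseteq> \<Union>P" using that part by (auto simp: cliques_def is_clique_def partition_on_def)
    fix A x y assume "A \<in> P" "x \<in> A \<inter> K" "y \<in> A \<inter> K"
    then show "x = y" using same[of x y] that by (auto simp: R_def)
  qed
  \<comment> \<open>The vertices of any t-clique lie in pairwise different classes.\<close>
  have tP: "t \<le> card P"
    using ne trans card_partial_transversal_le[OF finite_elements[OF fin part]]
    by (auto simp: cliques_def)
  \<comment> \<open>If related \<open>u\<close> and \<open>w\<close> were adjacent, adding
    \<open>w\<close> to a full transversal through \<open>u\<close> would give a clique, because the
    other members of the transversal lie outside the class of \<open>u\<close> and \<open>w\<close>.
    It has at least \<open>t\<close> vertices, so some t-clique would contain both.\<close>
  have nonadj: "{u, w} \<notin> E" if R: "(u, w) \<in> R" for u w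
  proof
    assume E: "{u, w} \<in> E"
    then have "u \<noteq> w" using G unfolding finite_simple_graph_def by fastforce
    have V: "u \<in> V" "w \<in> V" using R by (auto simp: R_def)
    obtain T where T: "partial_transversal P T" "u \<in> T" "card T = card P"
      using transversal_through[OF part V(1)] .
    have TV: "T \<subseteq> V" using clique[OF T(1)] by (simp add: is_clique_def)
    have "{x, w} \<in> E" if "x \<in> T" for x
    proof (cases "x = u")
      case False
      have "(x, u) \<notin> R"
        using same[of x u] T(1,2) that False by (auto simp: partial_transversal_def)
      then have "(x, w) \<notin> R"
        using R equiv by (meson equivE symD transD)
      then show ?thesis using adj TV V that by blast
    qed (use E in simp)
    then have "is_clique V E (insert w T)"
      using clique[OF T(1)] V unfolding is_clique_def by (auto simp: insert_commute)
    moreover obtain K where K: "{u, w} \<subseteq> K" "K \<subseteq> insert w T" "card K = t"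
    proof -
      have finT: "finite T" using TV fin finite_subset by blast
      have "card {u, w} \<le> t" using t \<open>u \<noteq> w\<close> by simp
      moreover have "t \<le> card (insert w T)" using tP T(3) finT by (simp add: card_insert_if)
      ultimately show ?thesis
        using exists_subset_between[of "{u, w}" t "insert w T"] that T(2) finT by auto
    qed
    ultimately have "K \<in> cliques V E t" using is_clique_subset by (auto simp: cliques_def)
    then show False using K(1) R \<open>u \<noteq> w\<close> by (auto simp: R_def)
  qed
  have "complete_multipartite_with_parts V E P"
    unfolding complete_multipartite_with_parts_def same
  proof (intro conjI ballI iffI part)
    fix x y assume "x \<in> V" "y \<in> V"
    then show "{x, y} \<in> E" if "(x, y) \<notin> R" using adj that by blast
    show "(x, y) \<notin> R" if "{x, y} \<in> E" using nonadj that by blast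
  qed
  then show ?thesis by (rule that)
qed

section \<open>Complete multipartite graphs: clique count and bound\<close>

lemma multipartite_card_cliques:
  assumes "finite V" "complete_multipartite_with_parts V E P"
  shows "real (card (cliques V E t)) = esym P t (\<lambda>A. real (card A))"
  unfolding cliques_def multipartite_is_clique_iff[OF assms(2)]
  by (rule card_partial_transversals[OF assms(1)])
    (use assms(2) in \<open>simp only: complete_multipartite_with_parts_def\<close>)

text \<open>All vertices have clique order \<open>card P\<close>, so the bound becomes Maclaurin's
  bound for the part sizes. As the clique count is \<open>esym\<close> of these sizes, equality here
  is equality in Maclaurin's inequality.\<close>

lemma multipartite_bound:
  assumes "finite V" "complete_multipartite_with_parts V E P" "t \<ge> 1"
  shows "real (card V) ^ (t - 1) * (\<Sum>v\<in>V. zykov_weight V E t v)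
    = real (card P choose t) * ((\<Sum>A\<in>P. real (card A)) / real (card P)) ^ t"
proof -
  have part: "partition_on V P" using assms(2) by (simp add: complete_multipartite_with_parts_def)
  have "card V = (\<Sum>A\<in>P. card A)"
    using assms(1) partition_onD1[OF part]
    by (intro product_partition[OF part]) (auto intro: finite_subset)
  then have n: "(\<Sum>A\<in>P. real (card A)) = real (card V)" by simp
  have "(\<Sum>v\<in>V. zykov_weight V E t v) = real (card V) * (real (card P choose t) / real (card P) ^ t)"
    using multipartite_vertex_clique_order[OF assms(1,2)] by (simp add: zykov_weight_def)
  moreover have "real (card V) ^ (t - 1) * real (card V) = real (card V) ^ t"
    using assms(3) by (cases t) auto
  ultimately show ?thesis unfolding n by (simp add: power_divide flip: mult.assoc)
qed

section \<open>The inequality and its equality case\<close>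

text \<open>The weighted inequality at the uniform weights, multiplied by
  \<open>real (card V) ^ t\<close>.\<close>

lemma zykov_inequality:
  assumes "finite V" "t \<ge> 1"
  shows "real (card (cliques V E t)) \<le> real (card V) ^ (t - 1) * (\<Sum>v\<in>V. zykov_weight V E t v)"
proof (cases "V = {}")
  case True
  then have "cliques V E t = {}" using assms(2) by (auto simp: cliques_def is_clique_def)
  then show ?thesis using True by simp
next
  case False
  then have n: "real (card V) > 0" using assms(1) by (simp add: card_gt_0_iff)
  have "family_poly (cliques V E t) (\<lambda>_. 1 / real (card V))
      \<le> (\<Sum>v\<in>V. zykov_weight V E t v * (1 / real (card V)))"
    using assms(1) False by (intro weighted_zykov) auto
  then have "real (card (cliques V E t)) / real (card V) ^ t \<le> (\<Sum>v\<in>V. zykov_weight V E t v) / real (card V)"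
    using family_poly_const[of "cliques V E t" t "1 / real (card V)"]
    by (simp add: cliques_def sum_divide_distrib power_divide)
  moreover have "real (card V) ^ t = real (card V) * real (card V) ^ (t - 1)"
    using assms(2) by (cases t) auto
  ultimately show ?thesis using n by (simp add: field_simps)
qed

text \<open>A clique with at least \<open>t\<close> vertices would contain a t-clique, so every
  clique order is below \<open>t\<close> and the binomial coefficient vanishes.\<close>

lemma zykov_weight_eq_0:
  assumes "finite V" "cliques V E t = {}" "v \<in> V"
  shows "zykov_weight V E t v = 0"
proof -
  obtain K where K: "is_clique V E K" "card K = vertex_clique_order V E v"
    using vertex_clique_order_attained[OF assms(1,3)] by metis
  have "\<not> t \<le> card K"
  proof
    assume "t \<le> card K"
    then obtain L where "L \<subseteq> K" "card L = t" using obtain_subset_with_card_n by metis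
    then show False using assms(2) is_clique_subset[OF K(1)] by (auto simp: cliques_def)
  qed
  then show ?thesis using K(2) by (simp add: zykov_weight_def binomial_eq_0)
qed

text \<open>Without t-cliques both sides are 0 whatever the graph looks like, hence the second
  disjunct. Otherwise the graph is complete multipartite, and unequal parts would make Maclaurin's
  inequality strict.\<close>

lemma zykov_equality:
  assumes G: "finite_simple_graph V E" and t: "t \<ge> 2"
  shows "real (card (cliques V E t)) = real (card V) ^ (t - 1) * (\<Sum>v\<in>V. zykov_weight V E t v)
    \<longleftrightarrow> regular_complete_multipartite V E \<or> cliques V E t = {}"
    (is "?eq \<longleftrightarrow> _")
proof -
  have fin: "finite V" using G by (simp add: finite_simple_graph_def)
  have part: "partition_on V P" if "complete_multipartite_with_parts V E P" for P
    using that by (simp add: complete_multipartite_with_parts_def)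
  show ?thesis
  proof (intro iffI disjCI; (elim disjE)?)
    assume eq: ?eq and ne: "cliques V E t \<noteq> {}"
    obtain P where P: "complete_multipartite_with_parts V E P"
      using equality_imp_multipartite[OF G t ne eq] .
    have finP: "finite P" using finite_elements[OF fin part[OF P]] .
    have pos: "real (card A) > 0" if "A \<in> P" for A
    proof -
      have "A \<subseteq> V" "A \<noteq> {}" using that part[OF P] by (auto simp: partition_on_def)
      then show ?thesis using fin by (simp add: card_gt_0_iff finite_subset)
    qed
    have tP: "t \<le> card P"
      using ne card_partial_transversal_le[OF finP] multipartite_is_clique_iff[OF P]
      by (auto simp: cliques_def)
    have "card A = card B" if "A \<in> P" "B \<in> P" for A B
    proof (rule ccontr)
      assume "card A \<noteq> card B"
      then have "real (card A) \<noteq> real (card B)" by simp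
      from maclaurin_strict[where x = "\<lambda>A. real (card A)", OF finP pos t tP that this]
      show False using eq multipartite_card_cliques[OF fin P, of t] multipartite_bound[OF fin P, of t] t by simp
    qed
    then show "regular_complete_multipartite V E"
      unfolding regular_complete_multipartite_def using P by blast
  next
    assume "regular_complete_multipartite V E"
    then obtain P where P: "complete_multipartite_with_parts V E P"
      and sizes: "\<And>A B. A \<in> P \<Longrightarrow> B \<in> P \<Longrightarrow> card A = card B"
      unfolding regular_complete_multipartite_def by blast
    have finP: "finite P" using finite_elements[OF fin part[OF P]] .
    obtain m where m: "\<And>A. A \<in> P \<Longrightarrow> card A = m" using sizes by blast
    have "esym P t (\<lambda>A. real (card A)) = real (card P choose t) * real m ^ t"
      using m by (intro esym_const finP) auto
    moreover have "(\<Sum>A\<in>P. real (card A)) = real (card P) * real m" using m by simp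
    \<comment> \<open>With no parts the mean is a division by 0, but then the binomial coefficient
      is 0 since \<open>t\<close> is positive.\<close>
    moreover have "card P choose t = 0 \<or> card P \<noteq> 0" using t by (cases "card P") auto
    ultimately show ?eq
      using multipartite_card_cliques[OF fin P, of t] multipartite_bound[OF fin P, of t] t by auto
  next
    assume "cliques V E t = {}"
    then show ?eq using zykov_weight_eq_0[OF fin] by simp
  qed
qed

text \<open>The disjunct \<open>num_cliques V E t = 0\<close> records the degenerate equality: for a
  path on four vertices and \<open>t = 3\<close> both sides are 0, although the path is not complete
  multipartite.\<close>

theorem theorem6:
  fixes V :: "'a set" and E :: "'a set set" and n t :: nat
  assumes "finite_simple_graph V E" and "card V = n" and "t \<ge> 2"
  shows "real (num_cliques V E t)
           \<le> real n ^ (t - 1) * (\<Sum>v\<in>V. 1 / real (vertex_clique_order V E v) ^ t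
                * real (vertex_clique_order V E v choose t))
       \<and> (real (num_cliques V E t)
           = real n ^ (t - 1) * (\<Sum>v\<in>V. 1 / real (vertex_clique_order V E v) ^ t
                * real (vertex_clique_order V E v choose t))
          \<longleftrightarrow> regular_complete_multipartite V E \<or> num_cliques V E t = 0)"
proof -
  have fin: "finite V" using assms(1) by (simp add: finite_simple_graph_def)
  have N: "num_cliques V E t = card (cliques V E t)"
    by (simp add: num_cliques_def cliques_def)
  have h: "1 / real (vertex_clique_order V E v) ^ t * real (vertex_clique_order V E v choose t)
    = zykov_weight V E t v" for v
    by (simp add: zykov_weight_def)
  have N0: "card (cliques V E t) = 0 \<longleftrightarrow> cliques V E t = {}"
    using finite_cliques[OF fin] by simp
  show ?thesis
    unfolding N h N0 assms(2)[symmetric]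
    using assms(3) by (intro conjI zykov_inequality[OF fin] zykov_equality[OF assms(1,3)]) simp
qed

end
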